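(* Fix any starting reference price $r_1\in[0,\bar p]$ at time $t=1$. (1a) If $\eta^+\ge\eta^-$, then the optimal pricing policy is a markdown policy, i.e. there is a price sequence $\mathbf p$ with $p_1\ge p_2\ge\dots\ge p_T$ and $V^{\mathbf p}(r_1)=V^*(r_1)$. (1b) If $\eta^+<\eta^-$, then there is a markdown policy $\mathbf p$ (i.e. $p_1\ge p_2\ge\dots\ge p_T$) such that $$V^*(r_1)-V^{\mathbf p}(r_1)=O\big(\bar p(\bar p-r_1)(\eta^-+\eta^+)\ln T\big),$$ where for $T\ge2$ the $O(\cdot)$ hides an absolute constant.
   Context: A seller sets prices $p_t\in[0,\bar p]$ for $t=1,\dots,T$, where $0<\bar p<\infty$. Write $x^+=\max\{x,0\}$. The expected demand at price $p$ and reference price $r$ is $D(p,r)=H(p)+\eta^+(r-p)^+-\eta^-(p-r)^+$, where $H:[0,\bar p]\to\mathbb R$ is a non-increasing base demand function and $\eta^+,\eta^-\ge 0$; it is assumed that $D(p,r)\ge 0$ for all $p,r\in[0,\bar p]$. The single-round expected revenue is $\mathrm{Rev}(p,r)=p\,D(p,r)$. Under the averaging reference mechanism (ARM), reference prices evolve by $r_{t+1}=\frac{t r_t+p_t}{t+1}$ from the given $r_1$. For $\mathbf p=(p_1,\dots,p_T)\in[0,\bar p]^T$, $V^{\mathbf p}(r_1)=\sum_{t=1}^T\mathrm{Rev}(p_t,r_t)$ and $V^*(r_1)=\sup_{\mathbf p\in[0,\bar p]^T}V^{\mathbf p}(r_1)$. An optimal pricing policy is a price sequence attaining this supremum; such sequences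 are assumed to exist (for every starting reference price in $[0,\bar p]$). A markdown policy is one whose price sequence is non-increasing in time. *)

theory Defs
  imports Complex_Main "HOL-Library.FuncSet"
begin

definition pos_part :: "real \<Rightarrow> real"
  where "pos_part x = max x 0"

definition demand :: "(real \<Rightarrow> real) \<Rightarrow> real \<Rightarrow> real \<Rightarrow> real \<Rightarrow> real \<Rightarrow> real"
  where "demand H \<eta>p \<eta>m p r = H p + \<eta>p * pos_part (r - p) - \<eta>m * pos_part (p - r)"

definition rev_single :: "(real \<Rightarrow> real) \<Rightarrow> real \<Rightarrow> real \<Rightarrow> real \<Rightarrow> real \<Rightarrow> real"
  where "rev_single H \<eta>p \<eta>m p r = p * demand H \<eta>p \<eta>m p r"

(* Time starts at t = 1, where the reference price is the given r1; the value at
   index 0 is a dummy that never enters the dynamics. *)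
primrec arm_ref :: "real \<Rightarrow> (nat \<Rightarrow> real) \<Rightarrow> nat \<Rightarrow> real"
  where
    "arm_ref r1 p 0 = r1"
  | "arm_ref r1 p (Suc t) =
       (if t = 0 then r1 else (real t * arm_ref r1 p t + p t) / (real t + 1))"

(* The cube [0, pbar]^T, with coordinates indexed by 1, ..., T. *)
definition price_seqs :: "real \<Rightarrow> nat \<Rightarrow> (nat \<Rightarrow> real) set"
  where "price_seqs pbar T = {1..T} \<rightarrow>\<^sub>E {0..pbar}"

definition total_rev ::
  "(real \<Rightarrow> real) \<Rightarrow> real \<Rightarrow> real \<Rightarrow> nat \<Rightarrow> (nat \<Rightarrow> real) \<Rightarrow> real \<Rightarrow> real"
  where "total_rev H \<eta>p \<eta>m T p r1 = (\<Sum>t = 1..T. rev_single H \<eta>p \<eta>m (p t) (arm_ref r1 p t))"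

(* H is non-increasing on [0, pbar], hence bounded there, and all reference prices stay in
   [0, pbar] when r1 does; so the supremum is over a nonempty bounded set of reals. *)
definition opt_rev ::
  "real \<Rightarrow> (real \<Rightarrow> real) \<Rightarrow> real \<Rightarrow> real \<Rightarrow> nat \<Rightarrow> real \<Rightarrow> real"
  where "opt_rev pbar H \<eta>p \<eta>m T r1 = (SUP p\<in>price_seqs pbar T. total_rev H \<eta>p \<eta>m T p r1)"

definition optimal_policy ::
  "real \<Rightarrow> (real \<Rightarrow> real) \<Rightarrow> real \<Rightarrow> real \<Rightarrow> nat \<Rightarrow> real \<Rightarrow> (nat \<Rightarrow> real) \<Rightarrow> bool"
  where "optimal_policy pbar H \<eta>p \<eta>m T r1 p \<longleftrightarrow>
    p \<in> price_seqs pbar T \<and> total_rev H \<eta>p \<eta>m T p r1 = opt_rev pbar H \<eta>p \<eta>m T r1"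

definition markdown_policy :: "real \<Rightarrow> nat \<Rightarrow> (nat \<Rightarrow> real) \<Rightarrow> bool"
  where "markdown_policy pbar T p \<longleftrightarrow> p \<in> price_seqs pbar T \<and> antimono_on {1..T} p"

(* The last conjunct is the standing assumption that optimal price sequences exist. *)
definition arm_model :: "real \<Rightarrow> (real \<Rightarrow> real) \<Rightarrow> real \<Rightarrow> real \<Rightarrow> nat \<Rightarrow> bool"
  where "arm_model pbar H \<eta>p \<eta>m T \<longleftrightarrow>
    0 < pbar \<and> 0 \<le> \<eta>p \<and> 0 \<le> \<eta>m \<and> 1 \<le> T \<and>
    antimono_on {0..pbar} H \<and>
    (\<forall>p\<in>{0..pbar}. \<forall>r\<in>{0..pbar}. 0 \<le> demand H \<eta>p \<eta>m p r) \<and>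
    (\<forall>r\<in>{0..pbar}. \<exists>p. optimal_policy pbar H \<eta>p \<eta>m T r p)"

end

theory Submission
  imports Defs "HOL-Combinatorics.Permutations"
begin

text \<open>
  Exchanging two adjacent prices with \<open>p t < p (t + 1)\<close> affects the revenue in rounds \<open>t\<close> and
  \<open>t + 1\<close> only, and does not lower it when \<open>\<eta>m \<le> \<eta>p\<close>; hence sorting a price sequence into
  non-increasing order does not lower the total revenue. If \<open>\<eta>p < \<eta>m\<close>, replace \<open>\<eta>m\<close> by \<open>\<eta>p\<close>:
  this can only raise revenues, so the sorted sequence \<open>q\<close> of an optimal one earns at least the
  optimum in the modified model. Going back to \<open>\<eta>m\<close> costs \<open>(\<eta>m - \<eta>p) * q t * (q t - r t)\<^sup>+\<close> in
  round \<open>t\<close>, and \<open>q t - r t \<le> (pbar - r1) / t\<close> because \<open>t * r t = r1 + q 1 + \<dots> + q (t - 1)\<close>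
  is at least \<open>r1 + (t - 1) * q t\<close>. The harmonic sum gives the logarithm.
\<close>

section \<open>Reference prices as averages\<close>

text \<open>Multiplying by \<open>t\<close> turns the recursion into a running sum. Hence a
  reference price depends on the earlier prices only through their sum, and reordering those prices
  does not change it.\<close>

lemma arm_ref_closed:
  assumes "1 \<le> t"
  shows "real t * arm_ref r1 p t = r1 + (\<Sum>i\<in>{1..<t}. p i)"
  using assms
proof (induction t rule: nat_induct_at_least)
  case base
  then show ?case by simp
next
  case (Suc t)
  have "real (Suc t) * arm_ref r1 p (Suc t) = real t * arm_ref r1 p t + p t"
    using Suc.hyps by (simp add: field_simps)
  then show ?case
    using Suc by simp
qed

lemma arm_ref_eq: "1 \<le> t \<Longrightarrow> arm_ref r1 p t = (r1 + (\<Sum>i\<in>{1..<t}. p i)) / real t"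
  using arm_ref_closed[of t r1 p] by (simp add: field_simps)

lemma arm_ref_mem:
  assumes "p \<in> price_seqs pbar T" "r1 \<in> {0..pbar}" "t \<in> {1..T}"
  shows "arm_ref r1 p t \<in> {0..pbar}"
proof -
  have p: "p i \<in> {0..pbar}" if "i \<in> {1..<t}" for i
    using assms that by (auto simp: price_seqs_def PiE_def Pi_def)
  have "(\<Sum>i\<in>{1..<t}. p i) \<le> (\<Sum>i\<in>{1..<t}. pbar)" "0 \<le> (\<Sum>i\<in>{1..<t}. p i)"
    using p by (intro sum_mono; simp) (intro sum_nonneg; use p in simp)
  moreover have "(\<Sum>i\<in>{1..<t}. pbar) = (real t - 1) * pbar"
    using assms by (simp add: of_nat_diff)
  ultimately show ?thesis
    using assms arm_ref_eq[of t r1 p]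
    by (auto simp: divide_le_eq algebra_simps intro!: divide_nonneg_nonneg)
qed

section \<open>Exchanging two adjacent prices\<close>

text \<open>Both sides charge \<open>a\<close> once and \<open>b\<close> once, so the terms
  \<open>x * H x\<close> cancel. What is left is a combination, with weights \<open>\<eta>m\<close>
  and \<open>\<eta>p - \<eta>m\<close>, of two gains that are shown nonnegative separately.\<close>

lemma rev_single_exchange:
  fixes a b r n :: real
  assumes "0 \<le> a" "a < b" "0 \<le> r" "0 \<le> n" "0 \<le> \<eta>m" "\<eta>m \<le> \<eta>p"
  shows "rev_single H \<eta>p \<eta>m a r + rev_single H \<eta>p \<eta>m b ((n * r + a) / (n + 1))
       \<le> rev_single H \<eta>p \<eta>m b r + rev_single H \<eta>p \<eta>m a ((n * r + b) / (n + 1))"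
proof -
  define k where "k = 1 / (n + 1)"
  have k: "0 < k" "k \<le> 1"
    using assms by (auto simp: k_def)
  \<comment> \<open>The second-round reference prices: \<open>r\<close> moves by the fraction
    \<open>k\<close> towards the price charged first, \<open>a\<close> for \<open>r'\<close> and
    \<open>b\<close> for \<open>r''\<close>.\<close>
  define r' where "r' = r - k * (r - a)"
  define r'' where "r'' = r + k * (b - r)"
  have r': "(n * r + a) / (n + 1) = r'" and r'': "(n * r + b) / (n + 1) = r''"
    using assms by (auto simp: r'_def r''_def k_def field_simps)
  \<comment> \<open>A linear demand response with slope \<open>\<eta>m\<close> plus a convex one with slope \<open>\<eta>p - \<eta>m\<close>.\<close>
  have rev: "rev_single H \<eta>p \<eta>m x y
      = x * H x + \<eta>m * (x * (y - x)) + (\<eta>p - \<eta>m) * (x * pos_part (y - x))" for x y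
    by (simp add: rev_single_def demand_def pos_part_def max_def algebra_simps)
  \<comment> \<open>The gain of the linear part; the products \<open>a * b\<close> cancel.\<close>
  have "b * (r - r') + a * (r'' - r) = k * (r * (b - a))"
    by (simp add: r'_def r''_def algebra_simps)
  also have "\<dots> \<ge> 0"
    using assms k by simp
  finally have lin: "\<eta>m * (b * (r - r') + a * (r'' - r)) \<ge> 0"
    using assms by simp
  have "b * (pos_part (r - b) - pos_part (r' - b)) + a * (pos_part (r'' - a) - pos_part (r - a)) \<ge> 0"
  proof (cases "b \<le> r")
    case True
    \<comment> \<open>The bracket weighted by \<open>b\<close> is at least
      \<open>k * (r - b)\<close>, the one weighted by \<open>a\<close> equals
      \<open>- (k * (r - b))\<close>, and \<open>a < b\<close>.\<close>
    have "r' - b = (1 - k) * (r - b) - k * (b - a)"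
      by (simp add: r'_def algebra_simps)
    also have "\<dots> \<le> (1 - k) * (r - b)"
      using k assms by simp
    finally have "pos_part (r' - b) \<le> (1 - k) * (r - b)"
      using k True by (simp add: pos_part_def)
    then have "k * (r - b) \<le> pos_part (r - b) - pos_part (r' - b)"
      using True by (simp add: pos_part_def algebra_simps)
    then have 1: "a * (k * (r - b)) \<le> b * (pos_part (r - b) - pos_part (r' - b))"
      using assms True k by (intro mult_mono) auto
    have "r'' - a = (1 - k) * (r - b) + (b - a)"
      by (simp add: r''_def algebra_simps)
    moreover have "0 \<le> (1 - k) * (r - b)"
      using k True by simp
    ultimately have "r'' - a \<ge> 0"
      using assms by linarith
    then have "pos_part (r'' - a) - pos_part (r - a) = - (k * (r - b))"
      using True assms by (simp add: pos_part_def r''_def algebra_simps)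
    with 1 show ?thesis
      by (simp only: mult_minus_right)
  next
    case False
    \<comment> \<open>Now \<open>r\<close> and \<open>r'\<close> are both at most \<open>b\<close>,
      so the bracket weighted by \<open>b\<close> vanishes; the other is nonnegative since
      \<open>r''\<close> is at least \<open>r\<close>.\<close>
    have "b - r' = (1 - k) * (b - r) + k * (b - a)"
      by (simp add: r'_def algebra_simps)
    then have "b - r' \<ge> 0"
      using k False assms by simp
    moreover have "r'' \<ge> r"
      using k False by (simp add: r''_def)
    then have "pos_part (r'' - a) \<ge> pos_part (r - a)"
      by (simp add: pos_part_def)
    ultimately show ?thesis
      using False assms by (simp add: pos_part_def)
  qed
  then have "(\<eta>p - \<eta>m) * (b * (pos_part (r - b) - pos_part (r' - b))
      + a * (pos_part (r'' - a) - pos_part (r - a))) \<ge> 0"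
    using assms by simp
  with lin show ?thesis
    unfolding r' r'' rev by (simp add: algebra_simps)
qed

lemma total_rev_transpose:
  assumes p: "p \<in> price_seqs pbar T" and r1: "r1 \<in> {0..pbar}"
    and t: "1 \<le> t" "Suc t \<le> T" and less: "p t < p (Suc t)"
    and \<eta>: "0 \<le> \<eta>m" "\<eta>m \<le> \<eta>p"
  shows "total_rev H \<eta>p \<eta>m T p r1 \<le> total_rev H \<eta>p \<eta>m T (p \<circ> transpose t (Suc t)) r1"
proof -
  let ?q = "p \<circ> transpose t (Suc t)"
  let ?f = "\<lambda>p i. rev_single H \<eta>p \<eta>m (p i) (arm_ref r1 p i)"
  \<comment> \<open>The prices entering the reference price at \<open>i\<close> include both swapped
    positions or neither, unless \<open>i = Suc t\<close>.\<close>
  have ref: "arm_ref r1 ?q i = arm_ref r1 p i" if i: "1 \<le> i" "i \<noteq> Suc t" for i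
  proof -
    have "(\<Sum>j\<in>{1..<i}. ?q j) = (\<Sum>j\<in>{1..<i}. p j)"
    proof (cases "i \<le> t")
      case True
      then show ?thesis
        by (intro sum.cong) (auto simp: transpose_def)
    next
      case False
      then have "transpose t (Suc t) permutes {1..<i}"
        using i t by (intro permutes_swap_id) auto
      then show ?thesis
        by (rule sum.permute[symmetric])
    qed
    then show ?thesis
      using i by (simp only: arm_ref_eq)
  qed
  have eq: "?f ?q i - ?f p i = 0" if "i \<in> {1..T} - {t, Suc t}" for i
    using that ref[of i] by (auto simp: transpose_def)
  have "p t \<ge> 0"
    using p t by (auto simp: price_seqs_def PiE_def Pi_def)
  moreover have "arm_ref r1 p t \<ge> 0"
    using arm_ref_mem[OF p r1, of t] t by auto
  ultimately have le: "?f p t + ?f p (Suc t) \<le> ?f ?q t + ?f ?q (Suc t)"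
    using rev_single_exchange[of "p t" "p (Suc t)" "arm_ref r1 p t" "real t" \<eta>m \<eta>p H]
      ref[of t] t less \<eta> by simp
  have "total_rev H \<eta>p \<eta>m T ?q r1 - total_rev H \<eta>p \<eta>m T p r1 = (\<Sum>i = 1..T. ?f ?q i - ?f p i)"
    by (simp add: total_rev_def sum_subtractf)
  also have "\<dots> = (\<Sum>i\<in>{t, Suc t}. ?f ?q i - ?f p i)"
    using eq t by (intro sum.mono_neutral_right) auto
  also have "\<dots> \<ge> 0"
    using le by simp
  finally show ?thesis by simp
qed

section \<open>Sorting by adjacent exchanges\<close>

text \<open>The sum drops by \<open>p (Suc t) - p t\<close>. It is the potential that shows that
  sorting by exchanges comes to an end.\<close>

lemma weighted_sum_transpose_less:
  fixes p :: "nat \<Rightarrow> real"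
  assumes t: "1 \<le> t" "Suc t \<le> T" and less: "p t < p (Suc t)"
  shows "(\<Sum>i = 1..T. real i * (p \<circ> transpose t (Suc t)) i) < (\<Sum>i = 1..T. real i * p i)"
proof -
  let ?q = "p \<circ> transpose t (Suc t)"
  have "(\<Sum>i = 1..T. real i * ?q i) - (\<Sum>i = 1..T. real i * p i)
      = (\<Sum>i = 1..T. real i * ?q i - real i * p i)"
    by (simp add: sum_subtractf)
  also have "\<dots> = (\<Sum>i\<in>{t, Suc t}. real i * ?q i - real i * p i)"
    using t by (intro sum.mono_neutral_right) (auto simp: transpose_def)
  also have "\<dots> < 0"
    using less by (simp add: algebra_simps)
  finally show ?thesis by simp
qed

text \<open>Among the finitely many rearrangements of \<open>p\<close> that earn at least as much as
  \<open>p\<close>, one with least weighted sum has no adjacent increase: exchanging such a pair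
  would stay in the set and lower the sum.\<close>

lemma ex_markdown_total_rev_ge:
  assumes p: "p \<in> price_seqs pbar T" and r1: "r1 \<in> {0..pbar}"
    and \<eta>: "0 \<le> \<eta>m" "\<eta>m \<le> \<eta>p"
  shows "\<exists>q. markdown_policy pbar T q \<and> total_rev H \<eta>p \<eta>m T p r1 \<le> total_rev H \<eta>p \<eta>m T q r1"
proof -
  define S where "S = {p \<circ> s | s. s permutes {1..T} \<and>
    total_rev H \<eta>p \<eta>m T p r1 \<le> total_rev H \<eta>p \<eta>m T (p \<circ> s) r1}"
  let ?W = "\<lambda>q. \<Sum>i = 1..T. real i * q i"
  have "S \<subseteq> (\<lambda>s. p \<circ> s) ` {s. s permutes {1..T}}"
    by (auto simp: S_def)
  then have "finite S"
    by (rule finite_subset) (simp add: finite_permutations)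
  moreover have "p \<in> S"
    unfolding S_def by (rule CollectI, rule exI[of _ id]) (simp add: permutes_id)
  ultimately obtain q where q: "q \<in> S" and min: "\<And>q'. q' \<in> S \<Longrightarrow> \<not> ?W q' < ?W q"
    using ex_is_arg_min_if_finite[of S ?W] by (auto simp: is_arg_min_def)
  obtain s where s: "q = p \<circ> s" "s permutes {1..T}"
    and ge: "total_rev H \<eta>p \<eta>m T p r1 \<le> total_rev H \<eta>p \<eta>m T q r1"
    using q by (auto simp: S_def)
  have qp: "q \<in> price_seqs pbar T"
    unfolding price_seqs_def
  proof (rule PiE_I)
    fix i assume "i \<in> {1..T}"
    then have "s i \<in> {1..T}"
      using s(2) by (simp only: permutes_in_image)
    then show "q i \<in> {0..pbar}"
      using p s(1) by (auto simp: price_seqs_def PiE_def Pi_def)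
  next
    \<comment> \<open>Price sequences are extensional; a permutation of \<open>{1..T}\<close> fixes
      the indices outside and so keeps the value \<open>undefined\<close> there.\<close>
    fix i assume "i \<notin> {1..T}"
    then show "q i = undefined"
      using p s permutes_not_in[OF s(2)] by (auto simp: price_seqs_def PiE_def extensional_def)
  qed
  have adjacent: "q (Suc t) \<le> q t" if t: "1 \<le> t" "Suc t \<le> T" for t
  proof (rule ccontr)
    assume "\<not> ?thesis"
    then have less: "q t < q (Suc t)" by simp
    let ?q = "q \<circ> transpose t (Suc t)"
    have "transpose t (Suc t) permutes {1..T}"
      using t by (intro permutes_swap_id) auto
    then have perm: "s \<circ> transpose t (Suc t) permutes {1..T}"
      using s(2) by (rule permutes_compose)
    have "?q = p \<circ> (s \<circ> transpose t (Suc t))"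
      by (simp add: s(1) o_assoc)
    moreover have "total_rev H \<eta>p \<eta>m T p r1 \<le> total_rev H \<eta>p \<eta>m T ?q r1"
      using ge total_rev_transpose[OF qp r1 t less \<eta>, of H] by (rule order_trans)
    ultimately have "?q \<in> S"
      using perm unfolding S_def by auto
    then show False
      using min weighted_sum_transpose_less[OF t less] by blast
  qed
  have "q j \<le> q i" if "i \<in> {1..T}" "j \<in> {1..T}" "i \<le> j" for i j
    using that(3,1,2)
  proof (induction j rule: dec_induct)
    case base
    then show ?case by simp
  next
    case (step n)
    then show ?case
      using adjacent[of n] by auto
  qed
  then have "markdown_policy pbar T q"
    using qp by (auto simp: markdown_policy_def monotone_on_def)
  with ge show ?thesis by blast
qed

section \<open>Boundedness of the revenue\<close>

lemma total_rev_le_opt_rev: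
  assumes "0 \<le> \<eta>p" "0 \<le> \<eta>m" and H: "antimono_on {0..pbar} H"
    and r1: "r1 \<in> {0..pbar}" and p: "p \<in> price_seqs pbar T"
  shows "total_rev H \<eta>p \<eta>m T p r1 \<le> opt_rev pbar H \<eta>p \<eta>m T r1"
proof -
  \<comment> \<open>The supremum is an upper bound only once the revenues are known to be bounded
    above. The absolute value keeps the second factor nonnegative, so that \<open>x\<close> may be
    replaced by \<open>pbar\<close>.\<close>
  have "rev_single H \<eta>p \<eta>m x r \<le> pbar * (\<bar>H 0\<bar> + \<eta>p * pbar)"
    if "x \<in> {0..pbar}" "r \<in> {0..pbar}" for x r
  proof -
    have "H x \<le> \<bar>H 0\<bar>"
      using monotone_onD[OF H, of 0 x] that by auto
    moreover have "\<eta>p * pos_part (r - x) \<le> \<eta>p * pbar" "0 \<le> \<eta>m * pos_part (x - r)"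
      using assms that by (auto simp: pos_part_def intro!: mult_left_mono mult_nonneg_nonneg)
    ultimately have "demand H \<eta>p \<eta>m x r \<le> \<bar>H 0\<bar> + \<eta>p * pbar"
      unfolding demand_def by linarith
    then have "x * demand H \<eta>p \<eta>m x r \<le> x * (\<bar>H 0\<bar> + \<eta>p * pbar)"
      using that by (intro mult_left_mono) auto
    also have "\<dots> \<le> pbar * (\<bar>H 0\<bar> + \<eta>p * pbar)"
      using that assms by (intro mult_right_mono) auto
    finally show ?thesis
      by (simp add: rev_single_def)
  qed
  then have "total_rev H \<eta>p \<eta>m T q r1 \<le> (\<Sum>t = 1..T. pbar * (\<bar>H 0\<bar> + \<eta>p * pbar))"
    if "q \<in> price_seqs pbar T" for q
    unfolding total_rev_def using that arm_ref_mem[OF that r1]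
    by (intro sum_mono) (auto simp: price_seqs_def PiE_def Pi_def)
  then have "bdd_above ((\<lambda>q. total_rev H \<eta>p \<eta>m T q r1) ` price_seqs pbar T)"
    by (rule bdd_aboveI2)
  with p show ?thesis
    unfolding opt_rev_def by (rule cSUP_upper)
qed

lemma arm_model_obtain_optimal:
  assumes "arm_model pbar H \<eta>p \<eta>m T" "r1 \<in> {0..pbar}"
  obtains p where "p \<in> price_seqs pbar T" "total_rev H \<eta>p \<eta>m T p r1 = opt_rev pbar H \<eta>p \<eta>m T r1"
  using assms unfolding arm_model_def optimal_policy_def by blast

section \<open>The cost of a larger penalty slope\<close>

lemma total_rev_antimono_eta:
  assumes "p \<in> price_seqs pbar T" "\<eta>m \<le> \<eta>m'"
  shows "total_rev H \<eta>p \<eta>m' T p r1 \<le> total_rev H \<eta>p \<eta>m T p r1"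
  unfolding total_rev_def rev_single_def demand_def
  using assms
  by (intro sum_mono mult_left_mono diff_left_mono mult_right_mono)
    (auto simp: pos_part_def price_seqs_def PiE_def Pi_def)

text \<open>Earlier markdown prices are at least \<open>q t\<close>, so only \<open>r1\<close>,
  which has weight \<open>1 / t\<close> in the average, can pull the reference price below
  \<open>q t\<close>.\<close>

lemma markdown_minus_ref_le:
  assumes q: "markdown_policy pbar T q" and r1: "r1 \<le> pbar" and t: "t \<in> {1..T}"
  shows "pos_part (q t - arm_ref r1 q t) \<le> (pbar - r1) / real t"
proof -
  have "(\<Sum>i\<in>{1..<t}. q t) \<le> (\<Sum>i\<in>{1..<t}. q i)"
    using q t by (intro sum_mono) (auto simp: markdown_policy_def monotone_on_def)
  then have "r1 + (real t - 1) * q t \<le> real t * arm_ref r1 q t"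
    using arm_ref_closed[of t r1 q] t by (simp add: of_nat_diff)
  moreover have "q t \<le> pbar"
    using q t by (auto simp: markdown_policy_def price_seqs_def PiE_def Pi_def)
  ultimately have "real t * (q t - arm_ref r1 q t) \<le> pbar - r1"
    by (simp add: algebra_simps)
  then show ?thesis
    using t r1 by (auto simp: pos_part_def field_simps)
qed

lemma markdown_total_rev_diff_le:
  assumes q: "markdown_policy pbar T q" and r1: "r1 \<le> pbar" and \<eta>: "\<eta>m \<le> \<eta>m'"
  shows "total_rev H \<eta>p \<eta>m T q r1 - total_rev H \<eta>p \<eta>m' T q r1
    \<le> (\<eta>m' - \<eta>m) * (pbar * (pbar - r1)) * (\<Sum>t = 1..T. 1 / real t)"
proof -
  have "total_rev H \<eta>p \<eta>m T q r1 - total_rev H \<eta>p \<eta>m' T q r1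
      = (\<Sum>t = 1..T. (\<eta>m' - \<eta>m) * (q t * pos_part (q t - arm_ref r1 q t)))"
    by (simp add: total_rev_def rev_single_def demand_def algebra_simps flip: sum_subtractf)
  also have "\<dots> \<le> (\<Sum>t = 1..T. (\<eta>m' - \<eta>m) * (pbar * ((pbar - r1) / real t)))"
    using \<eta> q markdown_minus_ref_le[OF q r1]
    by (intro sum_mono mult_left_mono mult_mono)
      (auto simp: pos_part_def markdown_policy_def price_seqs_def PiE_def Pi_def intro: order_trans)
  also have "\<dots> = (\<eta>m' - \<eta>m) * (pbar * (pbar - r1)) * (\<Sum>t = 1..T. 1 / real t)"
    by (simp add: sum_distrib_left mult.assoc)
  finally show ?thesis .
qed

lemma harmonic_le_ln:
  assumes "2 \<le> n"
  shows "(\<Sum>t = 1..n. 1 / real t) \<le> 3 * ln (real n)"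
proof -
  have "(\<Sum>t = 1..n. 1 / real t) \<le> 1 + ln (real n)"
    if "1 \<le> n" for n
    using that
  proof (induction n rule: nat_induct_at_least)
    case base
    then show ?case by simp
  next
    case (Suc n)
    \<comment> \<open>The bound \<open>ln x \<le> x - 1\<close> at \<open>x = n / (n + 1)\<close>
      makes each new term at most an increment of the logarithm.\<close>
    have "ln (real n / real (Suc n)) \<le> real n / real (Suc n) - 1"
      using Suc.hyps by (intro ln_le_minus_one) simp
    also have "\<dots> = - (1 / real (Suc n))"
      by (simp add: field_simps)
    finally have "1 / real (Suc n) \<le> ln (real (Suc n)) - ln (real n)"
      using Suc.hyps by (simp add: ln_div)
    then show ?case
      using Suc.IH by simp
  qed
  from this[of n] have "(\<Sum>t = 1..n. 1 / real t) \<le> 1 + ln (real n)"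
    using assms by simp
  \<comment> \<open>This absorbs the summand 1 into \<open>2 * ln n\<close>, which gives the factor
    3.\<close>
  moreover have "1 / 2 \<le> ln (2::real)"
    using ln_le_minus_one[of "1 / 2 :: real"] by (simp add: ln_div)
  moreover have "ln 2 \<le> ln (real n)"
    using assms by simp
  ultimately show ?thesis by linarith
qed

section \<open>Both cases of the theorem\<close>

theorem theorem1:
  shows "(\<forall>(pbar::real) (H::real \<Rightarrow> real) (\<eta>p::real) (\<eta>m::real) (T::nat) (r1::real).
            arm_model pbar H \<eta>p \<eta>m T \<longrightarrow> r1 \<in> {0..pbar} \<longrightarrow> \<eta>m \<le> \<eta>p \<longrightarrow>
            (\<exists>p. markdown_policy pbar T p \<and> optimal_policy pbar H \<eta>p \<eta>m T r1 p))
       \<and> (\<exists>C::real. C > 0 \<and>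
           (\<forall>(pbar::real) (H::real \<Rightarrow> real) (\<eta>p::real) (\<eta>m::real) (T::nat) (r1::real).
            arm_model pbar H \<eta>p \<eta>m T \<longrightarrow> r1 \<in> {0..pbar} \<longrightarrow> \<eta>p < \<eta>m \<longrightarrow> 2 \<le> T \<longrightarrow>
            (\<exists>p. markdown_policy pbar T p \<and>
              opt_rev pbar H \<eta>p \<eta>m T r1 - total_rev H \<eta>p \<eta>m T p r1
                \<le> C * (pbar * (pbar - r1) * (\<eta>m + \<eta>p) * ln (real T)))))"
proof (intro conjI exI[of _ "3::real"] allI impI)
  fix pbar :: real and H :: "real \<Rightarrow> real" and \<eta>p \<eta>m :: real and T :: nat and r1 :: real
  assume M: "arm_model pbar H \<eta>p \<eta>m T" and r1: "r1 \<in> {0..pbar}" and \<eta>: "\<eta>m \<le> \<eta>p"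
  obtain p where p: "p \<in> price_seqs pbar T"
    and opt: "total_rev H \<eta>p \<eta>m T p r1 = opt_rev pbar H \<eta>p \<eta>m T r1"
    using arm_model_obtain_optimal[OF M r1] .
  obtain q where q: "markdown_policy pbar T q"
    and ge: "total_rev H \<eta>p \<eta>m T p r1 \<le> total_rev H \<eta>p \<eta>m T q r1"
    using ex_markdown_total_rev_ge[OF p r1 _ \<eta>, of H] M unfolding arm_model_def by blast
  have "total_rev H \<eta>p \<eta>m T q r1 \<le> opt_rev pbar H \<eta>p \<eta>m T r1"
    using M q r1 by (intro total_rev_le_opt_rev) (auto simp: arm_model_def markdown_policy_def)
  then have "optimal_policy pbar H \<eta>p \<eta>m T r1 q"
    using q ge opt by (simp add: optimal_policy_def markdown_policy_def)
  with q show "\<exists>p. markdown_policy pbar T p \<and> optimal_policy pbar H \<eta>p \<eta>m T r1 p"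
    by blast
next
  fix pbar :: real and H :: "real \<Rightarrow> real" and \<eta>p \<eta>m :: real and T :: nat and r1 :: real
  assume M: "arm_model pbar H \<eta>p \<eta>m T" and r1: "r1 \<in> {0..pbar}" and \<eta>: "\<eta>p < \<eta>m" and T: "2 \<le> T"
  have nonneg: "0 \<le> \<eta>p" "0 \<le> pbar"
    using M by (auto simp: arm_model_def)
  obtain p where p: "p \<in> price_seqs pbar T"
    and opt: "total_rev H \<eta>p \<eta>m T p r1 = opt_rev pbar H \<eta>p \<eta>m T r1"
    using arm_model_obtain_optimal[OF M r1] .
  \<comment> \<open>Sorting takes place in the model with both slopes equal to
    \<open>\<eta>p\<close>, where the exchange argument applies although
    \<open>\<eta>p < \<eta>m\<close>.\<close>
  obtain q where q: "markdown_policy pbar T q"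
    and ge: "total_rev H \<eta>p \<eta>p T p r1 \<le> total_rev H \<eta>p \<eta>p T q r1"
    using ex_markdown_total_rev_ge[OF p r1 nonneg(1) order_refl] by blast
  have "opt_rev pbar H \<eta>p \<eta>m T r1 - total_rev H \<eta>p \<eta>m T q r1
      \<le> total_rev H \<eta>p \<eta>p T q r1 - total_rev H \<eta>p \<eta>m T q r1"
    using opt ge total_rev_antimono_eta[OF p, of \<eta>p \<eta>m H \<eta>p r1] \<eta> by simp
  also have "\<dots> \<le> (\<eta>m - \<eta>p) * (pbar * (pbar - r1)) * (\<Sum>t = 1..T. 1 / real t)"
    using markdown_total_rev_diff_le[OF q] r1 \<eta> by simp
  also have "\<dots> \<le> (\<eta>m + \<eta>p) * (pbar * (pbar - r1)) * (3 * ln (real T))"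
    using nonneg r1 \<eta> T harmonic_le_ln[OF T]
    by (intro mult_mono mult_nonneg_nonneg sum_nonneg) auto
  finally show "\<exists>p. markdown_policy pbar T p \<and>
      opt_rev pbar H \<eta>p \<eta>m T r1 - total_rev H \<eta>p \<eta>m T p r1
        \<le> 3 * (pbar * (pbar - r1) * (\<eta>m + \<eta>p) * ln (real T))"
    using q by (intro exI[of _ q]) (simp add: algebra_simps)
qed simp

end
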